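(* Let $\mathcal A$ be a finite alphabet equipped with a total order $<$, let $\pi\neq \mathrm{Id}$ be a permutation of $\mathcal A$, and let $w$ be a primitive word over $\mathcal A$. Then $w$ is clustering for the permutation $\pi$ (and the order $<$) if and only if every bispecial word $v$ in the language $\Lambda_w$ satisfies the following order condition: whenever $xvy$ and $x'vy'$ are in $\Lambda_w$ with letters $x\neq x'$ and $y\neq y'$, then $\pi^{-1}x<\pi^{-1}x'$ if and only if $y<y'$. Moreover, any bispecial word in $\Lambda_w$ is a factor of $ww$ and is of length at most $|w|-2$.
   Context: Words are finite sequences of letters; $|w|$ is the length of $w$. A (nonempty) word is primitive if it is not a power of another word. $\Lambda_w$ is the language of all (finite) factors of the one-sided infinite word $w^\omega=www\cdots$, including the empty word. A word $v\in\Lambda_w$ is right special (resp. left special) if $vx\in\Lambda_w$ (resp. $xv\in\Lambda_w$) for more than one letter $x$; it is bispecial if it is both right special and left special (the empty word may be bispecial). Clustering. Write $\mathcal A=\{a_1<a_2<\dots<a_r\}$. The (cyclic) conjugates of $w=w_1\cdots w_n$ are the words $w_i\cdots w_nw_1\cdots w_{i-1}$, $1\le i\le n$. The Burrows-Wheeler transform $B(w)$ is the word obtained by listing the $n$ conjugates of $w$ in ascending lexicographical order and reading the sequence of their last letters. The word $w$ is clustering for the permutation $\pi\ne \mathrm{Id}$ of $\mathcal A$ if $B(w)=(\pi a_1)^{n_{\pi a_1}}\cdots(\pi a_r)^{n_{\pi a_r}}$, where $n_a$ is the number of occurrences of $a$ in $w$ (some $n_a$ may be $0$). *)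

theory Defs
  imports
    "HOL-Library.List_Lexorder"
    "HOL-Library.Sublist"
    "HOL-Library.Omega_Words_Fun"
    "HOL-Combinatorics.Permutations"
begin

definition primitive :: "'a list \<Rightarrow> bool" where
  "primitive w \<longleftrightarrow> w \<noteq> [] \<and> (\<forall>u k. w = concat (replicate k u) \<longrightarrow> u = w)"

definition periodic_language :: "'a list \<Rightarrow> 'a list set" where
  "periodic_language w = {w\<^sup>\<omega> [i \<rightarrow> j] | i j. i \<le> j}"

definition right_special :: "'a list set \<Rightarrow> 'a list \<Rightarrow> bool" where
  "right_special L v \<longleftrightarrow> v \<in> L \<and> (\<exists>x y. x \<noteq> y \<and> v @ [x] \<in> L \<and> v @ [y] \<in> L)"

definition left_special :: "'a list set \<Rightarrow> 'a list \<Rightarrow> bool" where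
  "left_special L v \<longleftrightarrow> v \<in> L \<and> (\<exists>x y. x \<noteq> y \<and> [x] @ v \<in> L \<and> [y] @ v \<in> L)"

definition bispecial :: "'a list set \<Rightarrow> 'a list \<Rightarrow> bool" where
  "bispecial L v \<longleftrightarrow> right_special L v \<and> left_special L v"

(* Conjugates are listed with multiplicity; the order on lists is the lexicographic one. *)
definition burrows_wheeler :: "'a::linorder list \<Rightarrow> 'a list" where
  "burrows_wheeler w = map last (sort (map (\<lambda>i. rotate i w) [0..<length w]))"

definition clustering :: "'a::linorder set \<Rightarrow> ('a \<Rightarrow> 'a) \<Rightarrow> 'a list \<Rightarrow> bool" where
  "clustering A \<pi> w \<longleftrightarrow>
     burrows_wheeler w =
       concat (map (\<lambda>a. replicate (count_list w (\<pi> a)) (\<pi> a)) (sorted_list_of_set A))"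

definition order_condition :: "'a::linorder list set \<Rightarrow> ('a \<Rightarrow> 'a) \<Rightarrow> 'a list \<Rightarrow> bool" where
  "order_condition L \<pi> v \<longleftrightarrow>
     (\<forall>x x' y y'. [x] @ v @ [y] \<in> L \<and> [x'] @ v @ [y'] \<in> L \<and> x \<noteq> x' \<and> y \<noteq> y' \<longrightarrow>
        (inv \<pi> x < inv \<pi> x' \<longleftrightarrow> y < y'))"

end

theory Submission
  imports Defs
begin

text \<open>
  The Burrows-Wheeler transform is a rearrangement of \<open>w\<close>, and clustering for \<open>\<pi>\<close> prescribes the
  only rearrangement whose letters increase in the order \<open>x \<mapsto> inv \<pi> x\<close>. Hence
  (\<open>clustering_iff_sorted\<close>, \<open>sorted_burrows_wheeler_iff\<close>) clustering says that for any two
  rotations \<open>u < u'\<close> of \<open>w\<close>, the last letters \<open>x\<close> of \<open>u\<close> and \<open>x'\<close> of \<open>u'\<close> satisfy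
  \<open>inv \<pi> x \<le> inv \<pi> x'\<close>.

  This is the order condition in disguise, because the last letter of a rotation is also the letter
  that precedes it in \<open>w\<^sup>\<omega>\<close>. If \<open>v\<close> is the longest common prefix of rotations \<open>u < u'\<close> and
  \<open>y < y'\<close> are the letters that follow it, then \<open>xvy\<close> and \<open>x'vy'\<close> are in the language, so for
  \<open>x \<noteq> x'\<close> the word \<open>v\<close> is bispecial and the order condition compares \<open>x\<close> and \<open>x'\<close> as required.
  Conversely, words \<open>xvy\<close> and \<open>x'vy'\<close> with \<open>y < y'\<close> come from rotations that begin with \<open>vy\<close>
  and \<open>vy'\<close> and end with \<open>x\<close> and \<open>x'\<close> (\<open>short_factor_in_rotation\<close>), provided that \<open>vy\<close> is
  shorter than \<open>w\<close>.

  This proviso is the length bound of the second claim (\<open>right_special_length\<close>). Every factor of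
  length \<open>length w\<close> is a rotation of \<open>w\<close>, so it has the same letter counts as \<open>w\<close>; all its letters
  but the last therefore determine the last one, and a right special word has to be shorter than
  these \<open>length w - 1\<close> letters. By periodicity such a word has an occurrence that starts in the
  first copy of \<open>w\<close> in \<open>w\<^sup>\<omega>\<close>, and being so short it ends no later than the second copy.
\<close>

section \<open>Factors of a periodic word\<close>

text \<open>
  By periodicity an occurrence may be taken to start in the first copy of \<open>w\<close>, which turns
  questions about factors into arithmetic modulo \<open>length w\<close>.
\<close>

lemma mem_periodic_language_iff:
  assumes "w \<noteq> []"
  shows "u \<in> periodic_language w \<longleftrightarrow>
    (\<exists>i<length w. \<forall>k<length u. u ! k = w ! ((i + k) mod length w))"
proof
  assume "u \<in> periodic_language w"
  then obtain i j where ij: "i \<le> j" "u = w\<^sup>\<omega> [i \<rightarrow> j]"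
    by (auto simp: periodic_language_def)
  have "u ! k = w ! ((i mod length w + k) mod length w)" if "k < length u" for k
    using that ij assms by (simp add: subsequence_def iter_def mod_add_left_eq)
  then show "\<exists>i<length w. \<forall>k<length u. u ! k = w ! ((i + k) mod length w)"
    using assms by (intro exI[of _ "i mod length w"]) simp
next
  assume "\<exists>i<length w. \<forall>k<length u. u ! k = w ! ((i + k) mod length w)"
  then obtain i where i: "\<forall>k<length u. u ! k = w ! ((i + k) mod length w)" by blast
  have "u = w\<^sup>\<omega> [i \<rightarrow> i + length u]"
    using i assms by (intro nth_equalityI) (simp_all add: subsequence_def iter_def)
  then show "u \<in> periodic_language w"
    unfolding periodic_language_def by force
qed

lemma periodic_language_middle:
  assumes "w \<noteq> []" "p @ u @ s \<in> periodic_language w"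
  shows "u \<in> periodic_language w"
proof -
  obtain i where i: "\<And>k. k < length (p @ u @ s) \<Longrightarrow> (p @ u @ s) ! k = w ! ((i + k) mod length w)"
    using assms by (auto simp: mem_periodic_language_iff)
  have "u ! k = w ! (((i + length p) mod length w + k) mod length w)" if "k < length u" for k
    using i[of "length p + k"] that
    by (simp add: nth_append mod_add_left_eq add.assoc)
  then show ?thesis
    using assms(1) by (auto simp: mem_periodic_language_iff intro!: exI[of _ "(i + length p) mod length w"])
qed

lemma periodic_language_sublist:
  assumes "w \<noteq> []" "v \<in> periodic_language w" "length v \<le> length w"
  shows "sublist v (w @ w)"
proof -
  obtain i where i: "i < length w" "\<And>k. k < length v \<Longrightarrow> v ! k = w ! ((i + k) mod length w)"
    using assms by (auto simp: mem_periodic_language_iff)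
  have "v = take (length v) (drop i (w @ w))"
  proof (rule nth_equalityI)
    fix k assume k: "k < length v"
    have "v ! k = (w @ w) ! (i + k)"
      using i k assms(3) by (cases "i + k < length w") (simp_all add: nth_append le_mod_geq)
    then show "v ! k = take (length v) (drop i (w @ w)) ! k"
      using i(1) k by (simp del: drop_append take_append)
  qed (use i assms(3) in simp)
  then show ?thesis
    by (metis sublist_drop sublist_order.order_trans sublist_take)
qed

lemma mset_rotate1_eq: "mset (rotate1 xs) = mset xs"
  by (cases xs) simp_all

lemma mset_rotate_eq: "mset (rotate n xs) = mset xs"
  by (induction n) (simp_all add: mset_rotate1_eq)

lemma mset_full_period:
  assumes "w \<noteq> []" "u \<in> periodic_language w" "length u = length w"
  shows "mset u = mset w"
proof -
  obtain i where i: "\<forall>k<length u. u ! k = w ! ((i + k) mod length w)"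
    using assms by (auto simp: mem_periodic_language_iff)
  have "u = rotate i w"
    using i assms(3) by (intro nth_equalityI) (simp_all add: nth_rotate add.commute)
  then show ?thesis by (simp add: mset_rotate_eq)
qed

text \<open>
  If \<open>v\<close> had \<open>length w - 1\<close> letters or more, then completing its last \<open>length w - 1\<close> letters by
  either extension would give a full period. Both full periods have the letter counts of \<open>w\<close>, so
  the two extensions would agree.
\<close>

lemma right_special_length:
  assumes "w \<noteq> []" "right_special (periodic_language w) v"
  shows "length v + 2 \<le> length w"
proof (rule ccontr)
  assume long: "\<not> length v + 2 \<le> length w"
  obtain x y where xy: "x \<noteq> y" "v @ [x] \<in> periodic_language w" "v @ [y] \<in> periodic_language w"
    using assms(2) by (auto simp: right_special_def)
  \<comment> \<open>Dropping \<open>d\<close> letters leaves exactly \<open>length w - 1\<close> of them.\<close>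
  define d where "d = Suc (length v) - length w"
  have full: "mset (drop d v @ [z]) = mset w" if "v @ [z] \<in> periodic_language w" for z
  proof (rule mset_full_period[OF assms(1)])
    show "drop d v @ [z] \<in> periodic_language w"
      using periodic_language_middle[of w "take d v" "drop d v @ [z]" "[]"] that assms(1)
      by (metis append_Nil2 append_assoc append_take_drop_id)
    show "length (drop d v @ [z]) = length w"
      using long assms(1) unfolding d_def by (cases w) auto
  qed
  from full[OF xy(2)] full[OF xy(3)] have "mset (drop d v @ [x]) = mset (drop d v @ [y])" by simp
  with xy(1) show False by simp
qed

section \<open>Rotations and the letters preceding them\<close>

lemma last_rotate:
  assumes "i < length w"
  shows "last (rotate (Suc i) w) = w ! i"
proof -
  have "last (rotate (Suc i) w) = rotate (Suc i) w ! (length w - 1)"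
    using assms by (metis last_conv_nth length_greater_0_conv length_rotate less_zeroE list.size(3))
  also have "\<dots> = w ! ((Suc i + (length w - 1)) mod length w)"
    using assms by (intro nth_rotate) auto
  also have "Suc i + (length w - 1) = i + length w"
    using assms by auto
  finally show ?thesis using assms by simp
qed

text \<open>
  The rotation that starts right after the letter \<open>x\<close> of an occurrence of \<open>x # s\<close> is long enough
  to contain \<open>s\<close>, and it ends one period after that letter, hence with \<open>x\<close> again.
\<close>

lemma short_factor_in_rotation:
  assumes "w \<noteq> []" "x # s \<in> periodic_language w" "length s < length w"
  shows "\<exists>i t. rotate i w = s @ t \<and> last (rotate i w) = x"
proof -
  obtain i where i: "i < length w"
    "\<And>k. k < length (x # s) \<Longrightarrow> (x # s) ! k = w ! ((i + k) mod length w)"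
    using assms by (auto simp: mem_periodic_language_iff)
  have "s = take (length s) (rotate (Suc i) w)"
  proof (rule nth_equalityI)
    fix k assume k: "k < length s"
    then show "s ! k = take (length s) (rotate (Suc i) w) ! k"
      using i(2)[of "Suc k"] assms(3) by (simp add: nth_rotate del: rotate_Suc)
  qed (use assms(3) in simp)
  then have "rotate (Suc i) w = s @ drop (length s) (rotate (Suc i) w)"
    by (metis append_take_drop_id)
  moreover have "last (rotate (Suc i) w) = x"
    using i(2)[of 0] i(1) by (simp add: last_rotate del: rotate_Suc)
  ultimately show ?thesis by blast
qed

lemma last_rotation_precedes:
  assumes "w \<noteq> []"
  shows "last (rotate i w) # rotate i w \<in> periodic_language w"
proof -
  \<comment> \<open>The position before \<open>i\<close>, computed cyclically so that \<open>i = 0\<close> makes sense.\<close>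
  define j where "j = (i + (length w - 1)) mod length w"
  have j: "j < length w"
    using assms by (simp add: j_def)
  have "Suc j mod length w = (i + length w) mod length w"
    using assms by (simp add: j_def mod_Suc_eq flip: add_Suc_right)
  then have Suc_j: "Suc j mod length w = i mod length w" by simp
  have eq: "rotate i w = rotate (Suc j) w"
    using Suc_j by (metis rotate_conv_mod)
  have "(w ! j # rotate (Suc j) w) ! k = w ! ((j + k) mod length w)"
    if "k < Suc (length w)" for k
    using that j by (cases k) (simp_all add: nth_rotate del: rotate_Suc)
  then show ?thesis
    unfolding eq mem_periodic_language_iff[OF assms] last_rotate[OF j]
    using j by (intro exI[of _ j]) (simp del: rotate_Suc)
qed

section \<open>Clustering as monotonicity of last letters\<close>

text \<open>
  At equal lengths neither word is a proper prefix of the other, so a first difference decides.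
\<close>

lemma list_less_same_length_iff:
  fixes u u' :: "'a::linorder list"
  assumes "length u = length u'"
  shows "u < u' \<longleftrightarrow> (\<exists>v y y' t t'. u = v @ y # t \<and> u' = v @ y' # t' \<and> y < y')"
proof
  assume "u < u'"
  then show "\<exists>v y y' t t'. u = v @ y # t \<and> u' = v @ y' # t' \<and> y < y'"
    using assms by (auto simp: list_less_def lexord_def)
next
  assume "\<exists>v y y' t t'. u = v @ y # t \<and> u' = v @ y' # t' \<and> y < y'"
  then show "u < u'"
    unfolding list_less_def by (auto intro: lexord_append_left_rightI)
qed

text \<open>
  Equal entries may be listed several times without harm, since \<open>f\<close> agrees on them.
\<close>

lemma sorted_map_sort_iff:
  fixes f :: "'b::linorder \<Rightarrow> 'c::linorder"
  shows "sorted (map f (sort xs)) \<longleftrightarrow> (\<forall>u\<in>set xs. \<forall>u'\<in>set xs. u < u' \<longrightarrow> f u \<le> f u')"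
proof
  assume s: "sorted (map f (sort xs))"
  show "\<forall>u\<in>set xs. \<forall>u'\<in>set xs. u < u' \<longrightarrow> f u \<le> f u'"
  proof (intro ballI impI)
    fix u u' assume "u \<in> set xs" "u' \<in> set xs" "u < u'"
    then obtain i j where ij: "i < length xs" "j < length xs" "sort xs ! i = u" "sort xs ! j = u'"
      by (metis in_set_conv_nth length_sort set_sort)
    have "i \<le> j"
    proof (rule ccontr)
      assume "\<not> i \<le> j"
      then have "sort xs ! j \<le> sort xs ! i"
        using ij by (intro sorted_nth_mono) auto
      with ij \<open>u < u'\<close> show False by simp
    qed
    then show "f u \<le> f u'"
      using s ij sorted_nth_mono[OF s, of i j] by simp
  qed
next
  assume *: "\<forall>u\<in>set xs. \<forall>u'\<in>set xs. u < u' \<longrightarrow> f u \<le> f u'"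
  have "sorted_wrt (\<lambda>u u'. f u \<le> f u') (sort xs)"
  proof (rule sorted_wrt_mono_rel)
    show "sorted_wrt (\<le>) (sort xs)" by simp
    show "f u \<le> f u'" if "u \<in> set (sort xs)" "u' \<in> set (sort xs)" "u \<le> u'" for u u'
      using * that by (cases "u = u'") auto
  qed
  then show "sorted (map f (sort xs))" by (simp add: sorted_map)
qed

lemma sorted_concat_replicate:
  "sorted xs \<Longrightarrow> sorted (concat (map (\<lambda>a. replicate (c a) a) xs))"
  by (induction xs) (auto simp: sorted_append)

lemma mset_concat_replicate_count:
  assumes "distinct xs" "set u \<subseteq> set xs"
  shows "mset (concat (map (\<lambda>a. replicate (count_list u a) a) xs)) = mset u"
proof (rule multiset_eqI)
  fix b
  have "count (mset (concat (map (\<lambda>a. replicate (c a) a) xs))) b = (if b \<in> set xs then c b else 0)"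
    for c :: "'a \<Rightarrow> nat"
    using assms(1) by (induction xs) auto
  then show "count (mset (concat (map (\<lambda>a. replicate (count_list u a) a) xs))) b = count (mset u) b"
    using assms(2) by (auto simp: count_mset count_list_0_iff)
qed

text \<open>
  Sorting does not affect letter counts, and the last letters of the rotations, in the order of
  their starting positions, spell a rotation of \<open>w\<close>.
\<close>

lemma mset_burrows_wheeler:
  assumes "w \<noteq> []"
  shows "mset (burrows_wheeler w) = mset w"
proof -
  have "rotate1 (map (\<lambda>i. last (rotate i w)) [0..<length w]) = w" (is "rotate1 ?l = w")
  proof (rule nth_equalityI)
    fix k assume "k < length (rotate1 ?l)"
    then have k: "k < length w" by simp
    then have "rotate1 ?l ! k = last (rotate (Suc k mod length w) w)"
      using assms by (simp add: nth_rotate1)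
    also have "\<dots> = w ! k"
      using last_rotate[OF k] by (metis rotate_conv_mod)
    finally show "rotate1 ?l ! k = w ! k" .
  qed simp
  moreover have "mset (burrows_wheeler w) = mset ?l"
    by (simp add: burrows_wheeler_def image_mset.compositionality comp_def)
  ultimately show ?thesis by (metis mset_rotate1_eq)
qed

text \<open>
  Relabelling letters by \<open>inv \<pi>\<close> turns the prescribed word into the blocks of equal letters listed
  in increasing order. This is a sorted word with the letter counts of the relabelled \<open>w\<close>, and a
  sorted word is determined by its letter counts.
\<close>

lemma clustering_iff_sorted:
  assumes "finite A" "\<pi> permutes A" "set w \<subseteq> A" "w \<noteq> []"
  shows "clustering A \<pi> w \<longleftrightarrow> sorted (map (inv \<pi>) (burrows_wheeler w))"
proof -
  define c where "c = concat (map (\<lambda>a. replicate (count_list (map (inv \<pi>) w) a) a) (sorted_list_of_set A))"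
  have inv1: "inv \<pi> (\<pi> a) = a" and inv2: "\<pi> (inv \<pi> a) = a" for a
    using permutes_inverses[OF assms(2)] by auto
  have count: "count_list (map (inv \<pi>) w) a = count_list w (\<pi> a)" for a
    by (induction w) (auto simp: inv1 inv2)
  have "map \<pi> c = concat (map (\<lambda>a. replicate (count_list w (\<pi> a)) (\<pi> a)) (sorted_list_of_set A))"
    by (simp add: c_def count map_concat comp_def)
  then have "clustering A \<pi> w \<longleftrightarrow> burrows_wheeler w = map \<pi> c"
    by (simp add: clustering_def)
  also have "\<dots> \<longleftrightarrow> map (inv \<pi>) (burrows_wheeler w) = c"
    by (auto simp: comp_def inv1 inv2)
  also have "\<dots> \<longleftrightarrow> sorted (map (inv \<pi>) (burrows_wheeler w))"
  proof -
    have sc: "sorted c" unfolding c_def by (rule sorted_concat_replicate) simp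
    have "inv \<pi> ` set w \<subseteq> A"
      using assms(2,3) permutes_in_image[OF permutes_inv[OF assms(2)]] by auto
    then have mc: "mset c = mset (map (inv \<pi>) w)"
      unfolding c_def using assms(1) by (intro mset_concat_replicate_count) auto
    show ?thesis
      using sc mc mset_burrows_wheeler[OF assms(4)] properties_for_sort
      by (metis mset_map)
  qed
  finally show ?thesis .
qed

lemma sorted_burrows_wheeler_iff:
  fixes w :: "'a::linorder list" and f :: "'a \<Rightarrow> 'b::linorder"
  assumes "w \<noteq> []"
  shows "sorted (map f (burrows_wheeler w)) \<longleftrightarrow>
    (\<forall>i j. rotate i w < rotate j w \<longrightarrow> f (last (rotate i w)) \<le> f (last (rotate j w)))"
proof -
  have "rotate i w \<in> set (map (\<lambda>i. rotate i w) [0..<length w])" for i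
    using assms by (auto simp: image_iff intro!: bexI[of _ "i mod length w"] rotate_conv_mod)
  then have rotations: "set (map (\<lambda>i. rotate i w) [0..<length w]) = range (\<lambda>i. rotate i w)"
    by auto
  show ?thesis
    using sorted_map_sort_iff[of "f \<circ> last" "map (\<lambda>i. rotate i w) [0..<length w]"]
    unfolding rotations by (auto simp: burrows_wheeler_def)
qed

section \<open>The order condition characterises clustering\<close>

theorem theorem1:
  fixes A :: "'a::linorder set" and \<pi> :: "'a \<Rightarrow> 'a" and w :: "'a list"
  assumes "finite A"
    and "\<pi> permutes A" and "\<pi> \<noteq> id"
    and "set w \<subseteq> A" and "primitive w"
  shows "(clustering A \<pi> w \<longleftrightarrow>
            (\<forall>v. bispecial (periodic_language w) v \<longrightarrow>
                 order_condition (periodic_language w) \<pi> v))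
         \<and> (\<forall>v. bispecial (periodic_language w) v \<longrightarrow>
                 sublist v (w @ w) \<and> int (length v) \<le> int (length w) - 2)"
proof -
  let ?L = "periodic_language w"
  have w: "w \<noteq> []" using assms(5) by (simp add: primitive_def)
  have inj: "inv \<pi> x = inv \<pi> x' \<longleftrightarrow> x = x'" for x x'
    using permutes_inverses(1)[OF assms(2)] by metis
  have bound: "length v + 2 \<le> length w" if "bispecial ?L v" for v
    using that right_special_length[OF w] by (simp add: bispecial_def)
  \<comment> \<open>One implication of the order condition suffices: exchanging the two words gives the other
    one, as both orders are total.\<close>
  have increasing: "inv \<pi> x < inv \<pi> x'"
    if sorted: "sorted (map (inv \<pi>) (burrows_wheeler w))" and v: "bispecial ?L v"
      and L: "[x] @ v @ [y] \<in> ?L" "[x'] @ v @ [y'] \<in> ?L" and x: "x \<noteq> x'" and y: "y < y'"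
    for v x x' y y'
  proof -
    obtain i t where i: "rotate i w = (v @ [y]) @ t" "last (rotate i w) = x"
      using short_factor_in_rotation[OF w, of x "v @ [y]"] L bound[OF v] by auto
    obtain j t' where j: "rotate j w = (v @ [y']) @ t'" "last (rotate j w) = x'"
      using short_factor_in_rotation[OF w, of x' "v @ [y']"] L bound[OF v] by auto
    have "length (rotate i w) = length (rotate j w)" by simp
    from list_less_same_length_iff[OF this] have "rotate i w < rotate j w"
      using i(1) j(1) y by auto
    then have "inv \<pi> x \<le> inv \<pi> x'"
      using sorted i(2) j(2) unfolding sorted_burrows_wheeler_iff[OF w] by metis
    with x inj show ?thesis by (simp add: less_le)
  qed
  have "order_condition ?L \<pi> v"
    if "sorted (map (inv \<pi>) (burrows_wheeler w))" "bispecial ?L v" for v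
    unfolding order_condition_def
  proof (intro allI impI, elim conjE)
    fix x x' y y'
    assume "[x] @ v @ [y] \<in> ?L" "[x'] @ v @ [y'] \<in> ?L" "x \<noteq> x'" "y \<noteq> y'"
    then show "inv \<pi> x < inv \<pi> x' \<longleftrightarrow> y < y'"
      using increasing[OF that, of x y x' y'] increasing[OF that, of x' y' x y]
      by (metis linorder_less_linear order_less_asym)
  qed
  moreover have "sorted (map (inv \<pi>) (burrows_wheeler w))"
    if order: "\<And>v. bispecial ?L v \<Longrightarrow> order_condition ?L \<pi> v"
    unfolding sorted_burrows_wheeler_iff[OF w]
  proof (intro allI impI)
    fix i j
    assume "rotate i w < rotate j w"
    \<comment> \<open>\<open>v\<close> is the longest common prefix of the two rotations.\<close>
    then obtain v y y' t t' where
      u: "rotate i w = v @ y # t" "rotate j w = v @ y' # t'" and y: "y < y'"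
      using list_less_same_length_iff[of "rotate i w" "rotate j w"] by auto
    define x where "x = last (rotate i w)"
    define x' where "x' = last (rotate j w)"
    show "inv \<pi> (last (rotate i w)) \<le> inv \<pi> (last (rotate j w))"
    proof (cases "x = x'")
      case False
      have "[] @ ([x] @ v @ [y]) @ t \<in> ?L"
        using last_rotation_precedes[OF w, of i] by (simp add: u(1) x_def)
      then have xvy: "[x] @ v @ [y] \<in> ?L" by (rule periodic_language_middle[OF w])
      have "[] @ ([x'] @ v @ [y']) @ t' \<in> ?L"
        using last_rotation_precedes[OF w, of j] by (simp add: u(2) x'_def)
      then have xvy': "[x'] @ v @ [y'] \<in> ?L" by (rule periodic_language_middle[OF w])
      have "v \<in> ?L" "v @ [y] \<in> ?L" "[x] @ v \<in> ?L" "v @ [y'] \<in> ?L" "[x'] @ v \<in> ?L"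
        using periodic_language_middle[OF w, of "[x]" v "[y]"]
          periodic_language_middle[OF w, of "[x]" "v @ [y]" "[]"]
          periodic_language_middle[OF w, of "[]" "[x] @ v" "[y]"]
          periodic_language_middle[OF w, of "[x']" "v @ [y']" "[]"]
          periodic_language_middle[OF w, of "[]" "[x'] @ v" "[y']"] xvy xvy'
        by simp_all
      then have "bispecial ?L v"
        using False less_imp_neq[OF y]
        unfolding bispecial_def right_special_def left_special_def by blast
      then have "inv \<pi> x < inv \<pi> x'"
        using order xvy xvy' False y unfolding order_condition_def by (metis less_irrefl)
      then show ?thesis by (simp add: x_def x'_def)
    qed (simp add: x_def x'_def)
  qed
  ultimately have "clustering A \<pi> w \<longleftrightarrow> (\<forall>v. bispecial ?L v \<longrightarrow> order_condition ?L \<pi> v)"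
    unfolding clustering_iff_sorted[OF assms(1,2,4) w] by blast
  moreover have "sublist v (w @ w) \<and> int (length v) \<le> int (length w) - 2" if "bispecial ?L v" for v
    using periodic_language_sublist[OF w, of v] bound[OF that] that
    by (simp add: bispecial_def right_special_def)
  ultimately show ?thesis by blast
qed

end
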